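(* Let $n>3$ be an integer. The dimension of $\overline{FK}_{C_n}(n)$ equals the Lucas number $L_n$.
   Context: Let $F$ be a field and $n>3$. $\overline{FK}_{C_n}(n)$ is the quotient of the Fomin-Kirillov algebra $FK(n)$ by the ideal generated by the $x_{ij}$ for which $\{i,j\}$ is not an edge of the $n$-cycle $C_n$ (vertices $1,\dots,n$, edges $\overline{12},\overline{23},\dots,\overline{n-1,n},\overline{1n}$). Explicitly, it is the associative unital $F$-algebra on generators $x_{1n}=-x_{n1}$ and $x_{m,m+1}=-x_{m+1,m}$ ($1\le m\le n-1$), that is, the free associative algebra on the $n$ letters $x_{12},x_{23},\dots,x_{n-1,n},x_{1n}$ modulo the two-sided ideal generated by the relations - $x_{m,m+1}^2=0$ for $1\le m\le n-1$, and $x_{1n}^2=0$; - $x_{m,m+1}x_{m+1,m+2}=0$ and $x_{m+1,m+2}x_{m,m+1}=0$ for $1\le m\le n-2$; - $x_{n-1,n}x_{1n}=0$, $x_{1n}x_{n-1,n}=0$, $x_{12}x_{1n}=0$, $x_{1n}x_{12}=0$; - $x_{m,m+1}x_{l,l+1}-x_{l,l+1}x_{m,m+1}=0$ for $1\le m\le l-2$, $3\le l\le n-1$; - $x_{m,m+1}x_{1n}-x_{1n}x_{m,m+1}=0$ for $2\le m\le n-2$. Dimension means dimension as an $F$-vector space. The Lucas numbers are given by $L_0=2$, $L_1=1$, $L_{n}=L_{n-1}+L_{n-2}$. *)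

theory Defs
  imports "HOL-Library.Poly_Mapping" "HOL-Algebra.QuotRing" "HOL-Algebra.Embedded_Algebras"
begin

text \<open>
  Words over an alphabet, as an additive monoid under concatenation. The product that
  Poly_Mapping puts on finitely supported functions on a monoid is then the
  convolution product, i.e. the (noncommutative) product of the free associative algebra.
\<close>

datatype 'a free_word = FreeWord (letters: "'a list")

instantiation free_word :: (type) monoid_add
begin

definition zero_free_word :: "'a free_word" where
  "0 = FreeWord []"

definition plus_free_word :: "'a free_word \<Rightarrow> 'a free_word \<Rightarrow> 'a free_word" where
  "u + v = FreeWord (letters u @ letters v)"

instance
  by standard (simp_all add: zero_free_word_def plus_free_word_def)

end

type_synonym ('a, 'f) nc_poly = "'a free_word \<Rightarrow>\<^sub>0 'f"

definition free_algebra :: "'a set \<Rightarrow> ('a, 'f::field) nc_poly ring" where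
  "free_algebra X =
    \<lparr>carrier = {p. \<forall>w \<in> Poly_Mapping.keys p. set (letters w) \<subseteq> X},
     mult = (*), one = 1, zero = 0, add = (+)\<rparr>"

definition nc_const :: "'f::field \<Rightarrow> ('a, 'f) nc_poly" where
  "nc_const c = Poly_Mapping.single 0 c"

definition nc_var :: "'a \<Rightarrow> ('a, 'f::field) nc_poly" where
  "nc_var a = Poly_Mapping.single (FreeWord [a]) 1"

lemma free_algebra_simps:
  "mult (free_algebra X) = (*)" "one (free_algebra X) = 1"
  "zero (free_algebra X) = 0" "add (free_algebra X) = (+)"
  by (simp_all add: free_algebra_def)

lemma free_algebra_closed:
  fixes p q :: "('a, 'f::field) nc_poly"
  assumes "p \<in> carrier (free_algebra X)"
  shows "- p \<in> carrier (free_algebra X)"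
    and "q \<in> carrier (free_algebra X) \<Longrightarrow> p + q \<in> carrier (free_algebra X)"
    and "q \<in> carrier (free_algebra X) \<Longrightarrow> p - q \<in> carrier (free_algebra X)"
    and "q \<in> carrier (free_algebra X) \<Longrightarrow> p * q \<in> carrier (free_algebra X)"
proof -
  show "- p \<in> carrier (free_algebra X)"
    using assms by (simp add: free_algebra_def)
  assume q: "q \<in> carrier (free_algebra X)"
  show "p + q \<in> carrier (free_algebra X)"
    using assms q Poly_Mapping.keys_add[of p q] unfolding free_algebra_def by auto
  show "p - q \<in> carrier (free_algebra X)"
    using assms q keys_diff[of p q] unfolding free_algebra_def by auto
  show "p * q \<in> carrier (free_algebra X)"
  proof -
    have "set (letters w) \<subseteq> X" if w: "w \<in> Poly_Mapping.keys (p * q)" for w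
    proof -
      obtain u v where "w = u + v" "u \<in> Poly_Mapping.keys p" "v \<in> Poly_Mapping.keys q"
        using keys_mult[of p q] w by blast
      then show ?thesis
        using assms q by (auto simp: free_algebra_def plus_free_word_def)
    qed
    then show ?thesis
      by (simp add: free_algebra_def)
  qed
qed

lemma free_algebra_0_1_closed:
  "0 \<in> carrier (free_algebra X)" "1 \<in> carrier (free_algebra X)"
proof -
  show "0 \<in> carrier (free_algebra X)"
    by (simp add: free_algebra_def)
  show "1 \<in> carrier (free_algebra X)"
    by (simp add: free_algebra_def zero_free_word_def flip: single_one)
qed

lemma ring_free_algebra: "ring (free_algebra X)"
proof (intro ringI abelian_groupI monoidI)
  fix p :: "('a, 'f::field) nc_poly"
  assume "p \<in> carrier (free_algebra X)"
  then show "\<exists>q \<in> carrier (free_algebra X). q \<oplus>\<^bsub>free_algebra X\<^esub> p = \<zero>\<^bsub>free_algebra X\<^esub>"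
    by (intro bexI[where x = "- p"]) (simp_all add: free_algebra_simps free_algebra_closed(1))
qed (simp_all only: free_algebra_simps free_algebra_closed free_algebra_0_1_closed
       add_ac mult.assoc distrib_left distrib_right add_0_left add_0_right mult_1_left mult_1_right)

text \<open>
  The letter (i, j), with i < j, stands for the generator x_ij attached to the edge
  {i, j} of the n-cycle on the vertices 1, ..., n; the elements x_ji = - x_ij are not
  separate letters.
\<close>

type_synonym edge = "nat \<times> nat"

definition cycle_edges :: "nat \<Rightarrow> edge set" where
  "cycle_edges n = {(m, m + 1) | m. 1 \<le> m \<and> m \<le> n - 1} \<union> {(1, n)}"

abbreviation xgen :: "nat \<Rightarrow> nat \<Rightarrow> (edge, 'f::field) nc_poly" where
  "xgen i j \<equiv> nc_var (i, j)"

definition FK_cycle_relations :: "nat \<Rightarrow> (edge, 'f::field) nc_poly set" where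
  "FK_cycle_relations n =
     {xgen m (m+1) * xgen m (m+1) | m. 1 \<le> m \<and> m \<le> n - 1} \<union> {xgen 1 n * xgen 1 n} \<union>
     {xgen m (m+1) * xgen (m+1) (m+2) | m. 1 \<le> m \<and> m \<le> n - 2} \<union>
     {xgen (m+1) (m+2) * xgen m (m+1) | m. 1 \<le> m \<and> m \<le> n - 2} \<union>
     {xgen (n-1) n * xgen 1 n, xgen 1 n * xgen (n-1) n, xgen 1 2 * xgen 1 n, xgen 1 n * xgen 1 2} \<union>
     {xgen m (m+1) * xgen l (l+1) - xgen l (l+1) * xgen m (m+1) | m l.
        1 \<le> m \<and> m \<le> l - 2 \<and> 3 \<le> l \<and> l \<le> n - 1} \<union>
     {xgen m (m+1) * xgen 1 n - xgen 1 n * xgen m (m+1) | m. 2 \<le> m \<and> m \<le> n - 2}"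

definition FK_cycle_ideal :: "nat \<Rightarrow> (edge, 'f::field) nc_poly set" where
  "FK_cycle_ideal n = Idl\<^bsub>free_algebra (cycle_edges n)\<^esub> (FK_cycle_relations n)"

definition FK_cycle :: "nat \<Rightarrow> (edge, 'f::field) nc_poly set ring" where
  "FK_cycle n = free_algebra (cycle_edges n) Quot FK_cycle_ideal n"

lemma nc_var_in_carrier: "a \<in> A \<Longrightarrow> nc_var a \<in> carrier (free_algebra A)"
  by (simp add: nc_var_def free_algebra_def)

lemma FK_cycle_relations_subset:
  assumes "n > 3"
  shows "FK_cycle_relations n \<subseteq> carrier (free_algebra (cycle_edges n))"
proof -
  let ?C = "carrier (free_algebra (cycle_edges n)) :: (edge, 'f::field) nc_poly set"
  have "xgen m (m+1) \<in> ?C" if "1 \<le> m" "m \<le> n - 1" for m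
    using that by (intro nc_var_in_carrier) (auto simp: cycle_edges_def)
  moreover have "xgen (m+1) (m+2) \<in> ?C" if "1 \<le> m" "m \<le> n - 2" for m
    using that assms by (intro nc_var_in_carrier) (auto simp: cycle_edges_def)
  moreover have "xgen 1 2 \<in> ?C"
    using assms by (intro nc_var_in_carrier) (auto simp: cycle_edges_def intro!: exI[of _ 1])
  moreover have "xgen (n-1) n \<in> ?C"
    using assms by (intro nc_var_in_carrier) (auto simp: cycle_edges_def intro!: exI[of _ "n-1"])
  moreover have "xgen 1 n \<in> ?C"
    by (intro nc_var_in_carrier) (simp add: cycle_edges_def)
  moreover have "m \<le> n - 1" if "m \<le> n - 2" for m
    using that by linarith
  moreover have "1 \<le> l \<and> m \<le> n - 1" if "m \<le> l - 2" "3 \<le> l" "l \<le> n - 1" for m l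
    using that by linarith
  moreover have "1 \<le> m" if "2 \<le> m" for m :: nat
    using that by linarith
  ultimately show ?thesis
    unfolding FK_cycle_relations_def
    by safe (intro free_algebra_closed(3,4); blast)+
qed

lemma ideal_FK_cycle_ideal:
  "n > 3 \<Longrightarrow> ideal (FK_cycle_ideal n) (free_algebra (cycle_edges n))"
  unfolding FK_cycle_ideal_def
  by (intro ring.genideal_ideal ring_free_algebra FK_cycle_relations_subset)

lemma ring_FK_cycle: "n > 3 \<Longrightarrow> ring (FK_cycle n)"
  unfolding FK_cycle_def by (intro ideal.quotient_is_ring ideal_FK_cycle_ideal)

text \<open>
  The scalars F 1 inside the quotient. A field element c acts on the quotient as
  multiplication by the class of the constant c, so the F-dimension of the quotient is its
  dimension over this set of scalars in the sense of HOL-Algebra's dimension predicate.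
\<close>

definition FK_cycle_scalars :: "nat \<Rightarrow> (edge, 'f::field) nc_poly set set" where
  "FK_cycle_scalars n =
     range (\<lambda>c. FK_cycle_ideal n +>\<^bsub>free_algebra (cycle_edges n)\<^esub> nc_const c)"

fun lucas :: "nat \<Rightarrow> nat" where
  "lucas 0 = 2"
| "lucas (Suc 0) = 1"
| "lucas (Suc (Suc n)) = lucas (Suc n) + lucas n"

end

theory Submission
  imports Defs
begin

text \<open>
  The generators are the edges of the cycle. Two edges that share a vertex, and in particular
  an edge and itself, multiply to zero, and two disjoint edges commute. Hence a word whose
  letters are not distinct and pairwise disjoint vanishes in the quotient: its letters can be
  reordered until two that share a vertex stand side by side. Every other word depends only on
  its set of letters, which is a matching of the cycle. So the matchings span.

  For their linear independence, let \<open>arrangement_sum S p\<close> be the sum of the coefficients of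
  \<open>p\<close> over all words that list the set \<open>S\<close> without repetition. By
  \<open>arrangement_sum_mult\<close> these functionals satisfy a product rule in which only subsets of
  \<open>S\<close> occur; subsets of matchings are matchings, so the polynomials on which all
  matchings \<open>S\<close> evaluate to zero form an ideal. This ideal contains the defining relations,
  and by the reduction of words above it is no larger than the ideal they generate
  (\<open>I_eq_kernel\<close>). Thus the arrangement sums are well-defined coordinates on the quotient and are
  dual to the monomials of matchings. This argument works for any finite set of letters with a
  reflexive symmetric relation in place of sharing a vertex, which is the setting of the
  locale \<open>clash_ideal\<close>.

  It remains to count the matchings of the \<open>n\<close>-cycle. Numbering the edges along the cycle turns them
  into sets of integers without two cyclically consecutive elements. Those that avoid \<open>n\<close> are
  such sets on a path of \<open>n - 1\<close> points, those that contain \<open>n\<close> correspond to such sets on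
  a path of \<open>n - 3\<close> points, and the two path counts, which are Fibonacci numbers, add up to
  the Lucas number.
\<close>


section \<open>Arrangement sums\<close>

abbreviation nc_mono :: "'a list \<Rightarrow> 'f::field \<Rightarrow> ('a, 'f) nc_poly" where
  "nc_mono xs c \<equiv> Poly_Mapping.single (FreeWord xs) c"

definition arrangements :: "'a set \<Rightarrow> 'a free_word set" where
  "arrangements S = {w. distinct (letters w) \<and> set (letters w) = S}"

definition arrangement_sum :: "'a set \<Rightarrow> ('a, 'f::field) nc_poly \<Rightarrow> 'f" where
  "arrangement_sum S p = (\<Sum>w\<in>arrangements S. Poly_Mapping.lookup p w)"

lemma FreeWord_in_arrangements [simp]:
  "FreeWord xs \<in> arrangements S \<longleftrightarrow> distinct xs \<and> set xs = S"
  by (simp add: arrangements_def)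

lemma finite_arrangements [simp]: "finite (arrangements S)"
proof (cases "finite S")
  case True
  have "arrangements S \<subseteq> FreeWord ` {xs. set xs \<subseteq> S \<and> length xs = card S}"
  proof
    fix w assume "w \<in> arrangements S"
    then show "w \<in> FreeWord ` {xs. set xs \<subseteq> S \<and> length xs = card S}"
      by (cases w) (auto simp: distinct_card)
  qed
  then show ?thesis
    using finite_lists_length_eq[OF True] finite_subset by blast
next
  case False
  then have "arrangements S = {}"
    by (auto simp: arrangements_def)
  then show ?thesis by simp
qed

lemma arrangement_sum_zero [simp]: "arrangement_sum S 0 = 0"
  and arrangement_sum_add: "arrangement_sum S (p + q) = arrangement_sum S p + arrangement_sum S q"
  and arrangement_sum_diff: "arrangement_sum S (p - q) = arrangement_sum S p - arrangement_sum S q"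
  and arrangement_sum_uminus: "arrangement_sum S (- p) = - arrangement_sum S p"
  by (simp_all add: arrangement_sum_def lookup_add lookup_minus sum.distrib sum_subtractf sum_negf)

lemma arrangement_sum_sum:
  "arrangement_sum S (\<Sum>i\<in>A. f i) = (\<Sum>i\<in>A. arrangement_sum S (f i))"
  by (induction A rule: infinite_finite_induct) (simp_all add: arrangement_sum_add)

lemma arrangement_sum_single:
  "arrangement_sum S (Poly_Mapping.single w c) = (if w \<in> arrangements S then c else 0)"
  by (simp add: arrangement_sum_def lookup_single when_def)

lemma nc_poly_expand:
  fixes p :: "('a, 'f::field) nc_poly"
  shows "p = (\<Sum>w\<in>Poly_Mapping.keys p. Poly_Mapping.single w (Poly_Mapping.lookup p w))"
proof (rule poly_mapping_eqI)
  fix v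
  show "Poly_Mapping.lookup p v = Poly_Mapping.lookup
          (\<Sum>w\<in>Poly_Mapping.keys p. Poly_Mapping.single w (Poly_Mapping.lookup p w)) v"
    by (simp add: lookup_sum lookup_single when_def in_keys_iff)
qed

text \<open>
  The concatenation of \<open>u\<close> and \<open>v\<close> lists \<open>S\<close> without repetition exactly if \<open>u\<close> so lists some
  subset \<open>T\<close> of \<open>S\<close> and \<open>v\<close> its complement in \<open>S\<close>; the only candidate for \<open>T\<close> is the set of
  letters of \<open>u\<close>.
\<close>

lemma arrangement_sum_single_mult:
  assumes "finite S"
  shows "arrangement_sum S (Poly_Mapping.single u a * Poly_Mapping.single v b) =
    (\<Sum>T\<in>Pow S. arrangement_sum T (Poly_Mapping.single u a) *
                  arrangement_sum (S - T) (Poly_Mapping.single v b))"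
proof -
  have iff: "u \<in> arrangements T \<and> v \<in> arrangements (S - T) \<longleftrightarrow>
             T = set (letters u) \<and> u + v \<in> arrangements S" if "T \<subseteq> S" for T
    using that by (auto simp: arrangements_def plus_free_word_def)
  have "(\<Sum>T\<in>Pow S. arrangement_sum T (Poly_Mapping.single u a) *
                    arrangement_sum (S - T) (Poly_Mapping.single v b)) =
        (\<Sum>T\<in>Pow S. if u \<in> arrangements T \<and> v \<in> arrangements (S - T) then a * b else 0)"
    by (intro sum.cong) (auto simp: arrangement_sum_single)
  also have "\<dots> = (\<Sum>T\<in>Pow S. if T = set (letters u) \<and> u + v \<in> arrangements S then a * b else 0)"
    using iff by (intro sum.cong) auto
  also have "\<dots> = (if u + v \<in> arrangements S then a * b else 0)"
  proof (cases "u + v \<in> arrangements S")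
    case True
    then have "set (letters u) \<subseteq> S"
      by (auto simp: arrangements_def plus_free_word_def)
    with True assms show ?thesis by simp
  qed simp
  finally show ?thesis
    by (simp add: mult_single arrangement_sum_single)
qed

text \<open>
  Together the arrangement sums form an algebra homomorphism into the functions on finite sets of letters
  with disjoint-union convolution, that is, into the commutative algebra in which squares of
  letters vanish. Both sides are bilinear, so monomials suffice.
\<close>

lemma arrangement_sum_mult:
  assumes "finite S"
  shows "arrangement_sum S (p * q) =
    (\<Sum>T\<in>Pow S. arrangement_sum T p * arrangement_sum (S - T) q)"
proof -
  let ?s = "\<lambda>p w. Poly_Mapping.single w (Poly_Mapping.lookup p w)"
  have "arrangement_sum S (p * q) = arrangement_sum S
      ((\<Sum>u\<in>Poly_Mapping.keys p. ?s p u) * (\<Sum>v\<in>Poly_Mapping.keys q. ?s q v))"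
    using nc_poly_expand[of p] nc_poly_expand[of q] by simp
  also have "\<dots> = (\<Sum>u\<in>Poly_Mapping.keys p. \<Sum>v\<in>Poly_Mapping.keys q. \<Sum>T\<in>Pow S.
      arrangement_sum T (?s p u) * arrangement_sum (S - T) (?s q v))"
    by (simp add: sum_product arrangement_sum_sum arrangement_sum_single_mult[OF assms])
  also have "\<dots> = (\<Sum>u\<in>Poly_Mapping.keys p. \<Sum>T\<in>Pow S. \<Sum>v\<in>Poly_Mapping.keys q.
      arrangement_sum T (?s p u) * arrangement_sum (S - T) (?s q v))"
    by (intro sum.cong refl sum.swap)
  also have "\<dots> = (\<Sum>T\<in>Pow S. \<Sum>u\<in>Poly_Mapping.keys p. \<Sum>v\<in>Poly_Mapping.keys q.
      arrangement_sum T (?s p u) * arrangement_sum (S - T) (?s q v))"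
    by (rule sum.swap)
  also have "\<dots> = (\<Sum>T\<in>Pow S. arrangement_sum T (\<Sum>u\<in>Poly_Mapping.keys p. ?s p u) *
                    arrangement_sum (S - T) (\<Sum>v\<in>Poly_Mapping.keys q. ?s q v))"
    by (simp add: sum_product arrangement_sum_sum)
  finally show ?thesis
    using nc_poly_expand[of p] nc_poly_expand[of q] by simp
qed

section \<open>The kernel of the arrangement sums\<close>

text \<open>
  Since \<^const>\<open>pairwise\<close> compares only distinct elements, singletons are independent even
  for a reflexive relation.
\<close>

definition indep_sets :: "'a set \<Rightarrow> ('a \<Rightarrow> 'a \<Rightarrow> bool) \<Rightarrow> 'a set set" where
  "indep_sets X clash = {S. S \<subseteq> X \<and> pairwise (\<lambda>x y. \<not> clash x y) S}"

lemma indep_sets_mono: "S \<in> indep_sets X clash \<Longrightarrow> T \<subseteq> S \<Longrightarrow> T \<in> indep_sets X clash"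
  by (auto simp: indep_sets_def pairwise_def)

definition arrangement_kernel ::
    "'a set \<Rightarrow> ('a \<Rightarrow> 'a \<Rightarrow> bool) \<Rightarrow> ('a, 'f::field) nc_poly set" where
  "arrangement_kernel X clash =
     {p \<in> carrier (free_algebra X). \<forall>S\<in>indep_sets X clash. arrangement_sum S p = 0}"

text \<open>
  By the product rule, the value of a product at an independent set is a combination of the values of
  either factor at subsets of that set, which are again independent.
\<close>

lemma ideal_arrangement_kernel:
  fixes X :: "'a set"
  assumes "finite X"
  shows "ideal (arrangement_kernel X clash :: ('a, 'f::field) nc_poly set) (free_algebra X)"
proof -
  interpret A: ring "free_algebra X :: ('a, 'f) nc_poly ring" by (rule ring_free_algebra)
  have fin: "finite S" if "S \<in> indep_sets X clash" for S
    using that assms finite_subset by (auto simp: indep_sets_def)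
  have uminus: "\<ominus>\<^bsub>free_algebra X\<^esub> p = - p"
    if "p \<in> carrier (free_algebra X)" for p :: "('a, 'f) nc_poly"
    using A.minus_equality[of "- p" p] that free_algebra_closed(1)[OF that]
    by (simp add: free_algebra_simps)
  show ?thesis
  proof (intro idealI ring_free_algebra A.add.subgroupI, goal_cases)
    case 1
    show ?case by (auto simp: arrangement_kernel_def)
  next
    case 2
    have "0 \<in> arrangement_kernel X clash"
      by (simp add: arrangement_kernel_def free_algebra_0_1_closed)
    then show ?case by blast
  next
    case (3 p)
    then have p: "p \<in> carrier (free_algebra X)"
      by (simp add: arrangement_kernel_def)
    show ?case
      using 3 by (simp add: uminus[OF p] arrangement_kernel_def arrangement_sum_uminus free_algebra_closed)
  next
    case (4 p q)
    then show ?case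
      by (auto simp: arrangement_kernel_def arrangement_sum_add free_algebra_simps free_algebra_closed)
  next
    case (5 p q)
    have "arrangement_sum S (q * p) = 0" if "S \<in> indep_sets X clash" for S
    proof -
      have "arrangement_sum (S - T) p = 0" for T
        using 5 indep_sets_mono[OF that, of "S - T"] by (auto simp: arrangement_kernel_def)
      then show ?thesis by (simp add: arrangement_sum_mult[OF fin[OF that]])
    qed
    then show ?case
      using 5 by (simp add: arrangement_kernel_def free_algebra_simps free_algebra_closed)
  next
    case (6 p q)
    have "arrangement_sum S (p * q) = 0" if "S \<in> indep_sets X clash" for S
    proof -
      have "arrangement_sum T p = 0" if "T \<in> Pow S" for T
        using 6 indep_sets_mono[OF \<open>S \<in> indep_sets X clash\<close>, of T] that
        by (auto simp: arrangement_kernel_def)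
      then show ?thesis by (simp add: arrangement_sum_mult[OF fin[OF that]])
    qed
    then show ?case
      using 6 by (simp add: arrangement_kernel_def free_algebra_simps free_algebra_closed)
  qed
qed

section \<open>Reduction of words to independent sets\<close>

text \<open>
  A graph on the letters is given by \<open>clash\<close>; reflexivity lets the single relation
  \<open>clash_mult\<close> also say that squares of letters vanish. The last assumption is a lower bound on the
  quotient: no relations beyond the expected ones may have been imposed.
\<close>

locale clash_ideal =
  fixes X :: "'a set" and clash :: "'a \<Rightarrow> 'a \<Rightarrow> bool" and I :: "('a, 'f::field) nc_poly set"
  assumes fin: "finite X"
    and clash_refl: "x \<in> X \<Longrightarrow> clash x x"
    and clash_sym: "clash x y \<Longrightarrow> clash y x"
    and ideal_I: "ideal I (free_algebra X)"
    and clash_mult: "\<lbrakk>x \<in> X; y \<in> X; clash x y\<rbrakk> \<Longrightarrow> nc_var x * nc_var y \<in> I"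
    and commute: "\<lbrakk>x \<in> X; y \<in> X; \<not> clash x y\<rbrakk> \<Longrightarrow>
      nc_var x * nc_var y - nc_var y * nc_var x \<in> I"
    and I_subset_kernel: "I \<subseteq> arrangement_kernel X clash"
begin

sublocale ideal I "free_algebra X" by (rule ideal_I)

abbreviation congruent_mod :: "('a, 'f) nc_poly \<Rightarrow> ('a, 'f) nc_poly \<Rightarrow> bool" (infix "\<approx>" 50) where
  "p \<approx> q \<equiv> p - q \<in> I"

lemma I_zero: "0 \<in> I"
  using additive_subgroup.zero_closed[OF is_additive_subgroup] by (simp add: free_algebra_simps)

lemma I_add: "p \<in> I \<Longrightarrow> q \<in> I \<Longrightarrow> p + q \<in> I"
  using additive_subgroup.a_closed[OF is_additive_subgroup, of p q] by (simp add: free_algebra_simps)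

lemma const_in_carrier: "nc_const c \<in> carrier (free_algebra X)"
  by (simp add: nc_const_def free_algebra_def zero_free_word_def)

lemma mono_in_carrier: "set xs \<subseteq> X \<Longrightarrow> nc_mono xs c \<in> carrier (free_algebra X)"
  by (simp add: free_algebra_def)

lemma I_mult: "p \<in> I \<Longrightarrow> q \<in> carrier (free_algebra X) \<Longrightarrow> q * p \<in> I"
  "p \<in> I \<Longrightarrow> q \<in> carrier (free_algebra X) \<Longrightarrow> p * q \<in> I"
  using I_l_closed[of p q] I_r_closed[of p q] by (simp_all add: free_algebra_simps)

lemma I_uminus: "p \<in> I \<Longrightarrow> - p \<in> I"
  using I_mult(1)[of p "- 1"] free_algebra_closed(1)[OF free_algebra_0_1_closed(2)[of X]]
  by simp

lemma I_sum: "(\<And>i. i \<in> A \<Longrightarrow> f i \<in> I) \<Longrightarrow> (\<Sum>i\<in>A. f i) \<in> I"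
  by (induction A rule: infinite_finite_induct) (auto intro: I_zero I_add)

lemma congruent_sym: "p \<approx> q \<Longrightarrow> q \<approx> p"
  using I_uminus[of "p - q"] by simp

lemma congruent_trans [trans]: "p \<approx> q \<Longrightarrow> q \<approx> r \<Longrightarrow> p \<approx> r"
  using I_add[of "p - q" "q - r"] by simp

lemma I_congruent: "p \<approx> q \<Longrightarrow> q \<in> I \<Longrightarrow> p \<in> I"
  using I_add[of "p - q" q] by simp

lemma mono_Cons: "nc_mono (x # xs) 1 = nc_var x * (nc_mono xs 1 :: ('a, 'f) nc_poly)"
  by (simp add: nc_var_def mult_single plus_free_word_def)

lemma congruent_Cons:
  "x \<in> X \<Longrightarrow> nc_mono xs 1 \<approx> nc_mono ys 1 \<Longrightarrow> nc_mono (x # xs) 1 \<approx> nc_mono (x # ys) 1"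
  using I_mult(1)[OF _ nc_var_in_carrier] by (simp add: mono_Cons flip: right_diff_distrib)

lemma congruent_swap:
  assumes "x \<in> X" "y \<in> X" "\<not> clash x y" "set xs \<subseteq> X"
  shows "nc_mono (x # y # xs) 1 \<approx> nc_mono (y # x # xs) 1"
  using I_mult(2)[OF commute[OF assms(1-3)] mono_in_carrier[OF assms(4), of 1]]
  by (simp add: mono_Cons left_diff_distrib mult.assoc)

lemma congruent_move_front:
  assumes "set (us @ x # vs) \<subseteq> X" "\<forall>u\<in>set us. \<not> clash u x"
  shows "nc_mono (us @ x # vs) 1 \<approx> nc_mono (x # us @ vs) 1"
  using assms
proof (induction us)
  case Nil
  then show ?case by (simp add: I_zero)
next
  case (Cons u us)
  have "nc_mono (u # us @ x # vs) 1 \<approx> nc_mono (u # x # us @ vs) 1"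
    using Cons by (intro congruent_Cons) auto
  also have "nc_mono (u # x # us @ vs) 1 \<approx> nc_mono (x # u # us @ vs) 1"
    using Cons.prems by (intro congruent_swap) auto
  finally show ?case by simp
qed

text \<open>
  The letters of an independent set commute modulo the ideal, so the first letter of one
  arrangement can be moved to the front of the other, and induction handles the tails.
\<close>

lemma congruent_arrangements:
  assumes "distinct xs" "distinct ys" "set xs = set ys" "set xs \<in> indep_sets X clash"
  shows "nc_mono xs 1 \<approx> nc_mono ys 1"
  using assms
proof (induction xs arbitrary: ys)
  case Nil
  then show ?case by (simp add: I_zero)
next
  case (Cons x xs)
  from Cons.prems(3) have "x \<in> set ys" by auto
  then obtain us vs where ys: "ys = us @ x # vs"
    by (meson split_list)
  have X: "set ys \<subseteq> X" and indep: "pairwise (\<lambda>x y. \<not> clash x y) (set ys)"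
    using Cons.prems(3,4) by (auto simp: indep_sets_def)
  have "nc_mono xs 1 \<approx> nc_mono (us @ vs) 1"
  proof (rule Cons.IH)
    show "set xs = set (us @ vs)"
      using Cons.prems(1-3) by (auto simp: ys)
    show "set xs \<in> indep_sets X clash"
      using Cons.prems(4) by (rule indep_sets_mono) auto
  qed (use Cons.prems ys in auto)
  then have "nc_mono (x # xs) 1 \<approx> nc_mono (x # us @ vs) 1"
    using X ys by (intro congruent_Cons) auto
  also have "nc_mono (x # us @ vs) 1 \<approx> nc_mono ys 1"
    unfolding ys
  proof (rule congruent_sym, rule congruent_move_front, use X ys in simp, rule ballI)
    fix u assume "u \<in> set us"
    then show "\<not> clash u x"
      using indep Cons.prems(2) ys by (auto simp: pairwise_def)
  qed
  finally show ?case .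
qed

text \<open>
  Consider the shortest suffix that is not an arrangement of an independent set. Its first letter
  clashes with a later one (equal letters clash by reflexivity), and the tail may be rearranged
  to put that later letter right behind the first.
\<close>

lemma dependent_word_in_I:
  assumes "set xs \<subseteq> X" "\<not> (distinct xs \<and> set xs \<in> indep_sets X clash)"
  shows "nc_mono xs 1 \<in> I"
  using assms
proof (induction xs)
  case Nil
  then show ?case by (simp add: indep_sets_def)
next
  case (Cons x xs)
  show ?case
  proof (cases "distinct xs \<and> set xs \<in> indep_sets X clash")
    case False
    then show ?thesis
      using Cons I_mult(1)[OF _ nc_var_in_carrier] by (simp add: mono_Cons)
  next
    case True
    with Cons.prems obtain y where y: "y \<in> set xs" "clash x y"
      using clash_refl clash_sym by (auto simp: indep_sets_def pairwise_insert)
    then obtain us vs where xs: "xs = us @ y # vs"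
      by (meson split_list)
    have "nc_mono (x # xs) 1 \<approx> nc_mono (x # y # us @ vs) 1"
      using True Cons.prems by (intro congruent_Cons congruent_arrangements) (auto simp: xs)
    moreover have "nc_mono (x # y # us @ vs) 1 \<in> I"
      using I_mult(2)[OF clash_mult[OF _ _ y(2)] mono_in_carrier[of "us @ vs" 1]] Cons.prems(1)
      by (simp add: xs mono_Cons mult.assoc)
    ultimately show ?thesis
      by (rule I_congruent)
  qed
qed

definition listing :: "'a set \<Rightarrow> 'a list" where
  "listing S = (SOME xs. distinct xs \<and> set xs = S)"

lemma listing:
  assumes "S \<in> indep_sets X clash"
  shows "distinct (listing S)" "set (listing S) = S"
proof -
  have "finite S"
    using assms fin finite_subset by (auto simp: indep_sets_def)
  then have "\<exists>xs. distinct xs \<and> set xs = S"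
    using finite_distinct_list by blast
  then show "distinct (listing S)" "set (listing S) = S"
    unfolding listing_def by (metis (mono_tags, lifting) someI_ex)+
qed

text \<open>
  Each word is replaced by the chosen listing of its set of letters if this is allowed, and by
  zero otherwise. The definition through arrangement sums makes linearity evident, and makes the normal
  form vanish on the kernel.
\<close>

definition normal_form :: "('a, 'f) nc_poly \<Rightarrow> ('a, 'f) nc_poly" where
  "normal_form p = (\<Sum>S\<in>indep_sets X clash. nc_mono (listing S) (arrangement_sum S p))"

lemma normal_form_sum: "normal_form (\<Sum>i\<in>A. f i) = (\<Sum>i\<in>A. normal_form (f i))"
proof -
  have "normal_form 0 = 0"
    by (simp add: normal_form_def)
  moreover have "normal_form (p + q) = normal_form p + normal_form q" for p q
    by (simp add: normal_form_def arrangement_sum_add single_add sum.distrib)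
  ultimately show ?thesis
    by (induction A rule: infinite_finite_induct) simp_all
qed

lemma finite_indep_sets: "finite (indep_sets X clash)"
  using fin by (auto simp: indep_sets_def)

lemma congruent_normal_form_mono:
  assumes "set xs \<subseteq> X"
  shows "nc_mono xs c \<approx> normal_form (nc_mono xs c)"
proof -
  have scale: "nc_mono ys c = nc_const c * nc_mono ys 1" for ys :: "'a list"
    by (simp add: nc_const_def mult_single)
  have nf: "normal_form (nc_mono xs c) =
      (if distinct xs \<and> set xs \<in> indep_sets X clash then nc_mono (listing (set xs)) c else 0)"
  proof -
    have "normal_form (nc_mono xs c) = (\<Sum>S\<in>indep_sets X clash.
        if S = set xs then (if distinct xs then nc_mono (listing (set xs)) c else 0) else 0)"
      unfolding normal_form_def by (intro sum.cong) (auto simp: arrangement_sum_single)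
    then show ?thesis
      using finite_indep_sets by simp
  qed
  show ?thesis
  proof (cases "distinct xs \<and> set xs \<in> indep_sets X clash")
    case True
    then have "nc_mono xs 1 \<approx> nc_mono (listing (set xs)) 1"
      by (intro congruent_arrangements) (simp_all add: listing)
    then show ?thesis
      using I_mult(1)[OF _ const_in_carrier[of c]] True
      unfolding nf unfolding scale[of xs] scale[of "listing (set xs)"]
      by (simp flip: right_diff_distrib)
  next
    case False
    then show ?thesis
      using I_mult(1)[OF dependent_word_in_I[OF assms False] const_in_carrier[of c]]
      unfolding nf if_not_P[OF False] unfolding scale[of xs] by simp
  qed
qed

lemma congruent_normal_form:
  assumes "p \<in> carrier (free_algebra X)"
  shows "p \<approx> normal_form p"
proof -
  let ?s = "\<lambda>w. Poly_Mapping.single w (Poly_Mapping.lookup p w)"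
  have "?s w \<approx> normal_form (?s w)" if "w \<in> Poly_Mapping.keys p" for w
    using that assms congruent_normal_form_mono[of "letters w"] by (simp add: free_algebra_def)
  then have "(\<Sum>w\<in>Poly_Mapping.keys p. ?s w - normal_form (?s w)) \<in> I"
    by (rule I_sum)
  then show ?thesis
    using nc_poly_expand[of p] by (simp add: sum_subtractf flip: normal_form_sum)
qed

text \<open>
  A polynomial in the kernel is congruent to its normal form, which is zero. This is the upper
  bound on the quotient.
\<close>

lemma I_eq_kernel: "I = arrangement_kernel X clash"
proof
  show "arrangement_kernel X clash \<subseteq> I"
  proof
    fix p :: "('a, 'f) nc_poly"
    assume p: "p \<in> arrangement_kernel X clash"
    then have "normal_form p = 0"
      by (simp add: arrangement_kernel_def normal_form_def)
    then show "p \<in> I"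
      using p congruent_normal_form[of p] by (simp add: arrangement_kernel_def)
  qed
qed (rule I_subset_kernel)

lemma mem_I_iff:
  "p \<in> I \<longleftrightarrow> p \<in> carrier (free_algebra X) \<and>
     (\<forall>S\<in>indep_sets X clash. arrangement_sum S p = 0)"
  by (subst I_eq_kernel) (simp add: arrangement_kernel_def)

section \<open>Dimension of the quotient\<close>

abbreviation cls :: "('a, 'f) nc_poly \<Rightarrow> ('a, 'f) nc_poly set" where
  "cls p \<equiv> I +>\<^bsub>free_algebra X\<^esub> p"

abbreviation quot :: "('a, 'f) nc_poly set ring" where
  "quot \<equiv> free_algebra X Quot I"

sublocale Q: ring quot by (rule quotient_is_ring)

lemma cls_add:
  "\<lbrakk>p \<in> carrier (free_algebra X); q \<in> carrier (free_algebra X)\<rbrakk> \<Longrightarrow>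
     cls p \<oplus>\<^bsub>quot\<^esub> cls q = cls (p + q)"
  using a_rcos_sum[of p q] by (simp add: FactRing_def free_algebra_simps)

lemma cls_mult:
  "\<lbrakk>p \<in> carrier (free_algebra X); q \<in> carrier (free_algebra X)\<rbrakk> \<Longrightarrow>
     cls p \<otimes>\<^bsub>quot\<^esub> cls q = cls (p * q)"
  using rcoset_mult_add[of p q] by (simp add: FactRing_def free_algebra_simps)

lemma carrier_quot: "carrier quot = cls ` carrier (free_algebra X)"
  by (auto simp: FactRing_def A_RCOSETS_def')

lemma cls_eq_iff:
  assumes "p \<in> carrier (free_algebra X)" "q \<in> carrier (free_algebra X)"
  shows "cls p = cls q \<longleftrightarrow> p \<approx> q"
proof -
  have "\<ominus>\<^bsub>free_algebra X\<^esub> q = - q"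
    using minus_equality[of "- q" q] assms(2) free_algebra_closed(1)[OF assms(2)]
    by (simp add: free_algebra_simps)
  then have "p \<ominus>\<^bsub>free_algebra X\<^esub> q = p - q"
    by (simp add: a_minus_def free_algebra_simps)
  then show ?thesis
    using quotient_eq_iff_same_a_r_cos[OF ideal_I assms] by simp
qed

definition scalars :: "('a, 'f) nc_poly set set" where
  "scalars = range (\<lambda>c. cls (nc_const c))"

abbreviation basis_element :: "'a set \<Rightarrow> ('a, 'f) nc_poly set" where
  "basis_element S \<equiv> cls (nc_mono (listing S) 1)"

lemma listing_in_carrier:
  "S \<in> indep_sets X clash \<Longrightarrow> nc_mono (listing S) c \<in> carrier (free_algebra X)"
  by (intro mono_in_carrier) (auto simp: listing indep_sets_def)

lemma arrangement_sum_listing: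
  "S \<in> indep_sets X clash \<Longrightarrow>
    arrangement_sum T (nc_mono (listing S) c) = (if T = S then c else 0)"
  by (auto simp: arrangement_sum_single listing)

text \<open>
  Representatives of the classes that only involve the basis elements of \<open>C\<close>. The extreme cases
  are the ideal itself, for empty \<open>C\<close>, and the whole free algebra, when \<open>C\<close> contains all independent sets.
\<close>

definition supported_on :: "'a set set \<Rightarrow> ('a, 'f) nc_poly set" where
  "supported_on C = {p \<in> carrier (free_algebra X).
     \<forall>S\<in>indep_sets X clash - C. arrangement_sum S p = 0}"

text \<open>
  Adding \<open>S\<close> to the list allows one more coordinate to be nonzero: the coefficient of the
  new basis element in the class of \<open>p\<close> is \<open>arrangement_sum S p\<close>, and after subtracting this
  multiple the other coordinates are unchanged.
\<close>

lemma Span_basis_elements: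
  assumes "set Ss \<subseteq> indep_sets X clash"
  shows "Q.Span scalars (map basis_element Ss) = cls ` supported_on (set Ss)"
  using assms
proof (induction Ss)
  case Nil
  have "supported_on {} = I"
    by (auto simp: supported_on_def mem_I_iff)
  moreover have "cls p = I" if "p \<in> I" for p
    using a_rcos_const that by blast
  ultimately have "cls ` supported_on {} = {I}"
    using I_zero by auto
  moreover have "\<zero>\<^bsub>quot\<^esub> = I"
    by (simp add: FactRing_def)
  ultimately show ?case
    by simp
next
  case (Cons S Ss)
  then have S: "S \<in> indep_sets X clash" by simp
  let ?b = "\<lambda>c. nc_mono (listing S) c"
  have scaled: "cls (nc_const c) \<otimes>\<^bsub>quot\<^esub> basis_element S = cls (?b c)" for c
    using cls_mult[OF const_in_carrier listing_in_carrier[OF S]]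
    by (simp add: nc_const_def mult_single)
  have "Q.Span scalars (map basis_element (S # Ss)) =
      Q.line_extension scalars (basis_element S) (cls ` supported_on (set Ss))"
    using Cons by simp
  also have "\<dots> = cls ` supported_on (set (S # Ss))"
  proof (intro equalityI subsetI)
    fix z assume "z \<in> Q.line_extension scalars (basis_element S) (cls ` supported_on (set Ss))"
    then obtain c p where p: "p \<in> supported_on (set Ss)" and z: "z = cls (?b c) \<oplus>\<^bsub>quot\<^esub> cls p"
      unfolding Q.line_extension_mem_iff scalars_def using scaled by auto
    from p have pc: "p \<in> carrier (free_algebra X)"
      by (simp add: supported_on_def)
    have "?b c + p \<in> supported_on (set (S # Ss))"
      using p S
      by (auto simp: supported_on_def free_algebra_closed(2) listing_in_carrier
          arrangement_sum_add arrangement_sum_listing)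
    then show "z \<in> cls ` supported_on (set (S # Ss))"
      using cls_add[OF listing_in_carrier[OF S] pc] z by auto
  next
    fix z assume "z \<in> cls ` supported_on (set (S # Ss))"
    then obtain p where p: "p \<in> supported_on (set (S # Ss))" and z: "z = cls p" by blast
    let ?c = "arrangement_sum S p"
    from p have pc: "p \<in> carrier (free_algebra X)"
      by (simp add: supported_on_def)
    \<comment> \<open>subtracting this multiple of the basis element kills exactly the coordinate at \<open>S\<close>\<close>
    have rest: "p - ?b ?c \<in> supported_on (set Ss)"
      using p S
      by (auto simp: supported_on_def free_algebra_closed(3) listing_in_carrier
          arrangement_sum_diff arrangement_sum_listing)
    have "z = cls (nc_const ?c) \<otimes>\<^bsub>quot\<^esub> basis_element S \<oplus>\<^bsub>quot\<^esub> cls (p - ?b ?c)"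
      unfolding scaled z
      using cls_add[OF listing_in_carrier[OF S, of ?c]
          free_algebra_closed(3)[OF pc listing_in_carrier[OF S, of ?c]]]
      by simp
    then show "z \<in> Q.line_extension scalars (basis_element S) (cls ` supported_on (set Ss))"
      unfolding Q.line_extension_mem_iff scalars_def using rest by blast
  qed
  finally show ?case .
qed

text \<open>
  The arrangement sum at \<open>S\<close> is constant on classes. It is one on the basis element of \<open>S\<close> and
  zero on the span of the others.
\<close>

lemma independent_basis_elements:
  assumes "distinct Ss" "set Ss \<subseteq> indep_sets X clash"
  shows "Q.independent scalars (map basis_element Ss)"
  using assms
proof (induction Ss)
  case (Cons S Ss)
  then have S: "S \<in> indep_sets X clash" "S \<notin> set Ss" by auto
  have "basis_element S \<notin> cls ` supported_on (set Ss)"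
  proof
    assume "basis_element S \<in> cls ` supported_on (set Ss)"
    then obtain p where p: "p \<in> supported_on (set Ss)" "basis_element S = cls p" by blast
    then have "nc_mono (listing S) 1 \<approx> p"
      using cls_eq_iff[OF listing_in_carrier[OF S(1)], of p] by (simp add: supported_on_def)
    then have "arrangement_sum S (nc_mono (listing S) 1 - p) = 0"
      using S(1) unfolding mem_I_iff by blast
    moreover have "arrangement_sum S p = 0"
      using p(1) S by (simp add: supported_on_def)
    ultimately show False
      using S(1) by (simp add: arrangement_sum_diff arrangement_sum_listing)
  qed
  then show ?case
    using Cons S Span_basis_elements[of Ss]
    by (auto intro!: Q.li_Cons simp: carrier_quot listing_in_carrier simp del: Q.Span.simps)
qed simp

theorem dimension_quot:
  "ring.dimension quot (card (indep_sets X clash)) scalars (carrier quot)"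
proof -
  obtain Ss where Ss: "distinct Ss" "set Ss = indep_sets X clash"
    using finite_distinct_list[OF finite_indep_sets] by blast
  have "Q.dimension (length (map basis_element Ss)) scalars (Q.Span scalars (map basis_element Ss))"
    using Ss by (intro Q.dimension_independent independent_basis_elements) simp_all
  moreover have "Q.Span scalars (map basis_element Ss) = carrier quot"
    using Ss Span_basis_elements[of Ss] by (simp add: carrier_quot supported_on_def del: Q.Span.simps)
  ultimately show ?thesis
    using Ss distinct_card[of Ss] by simp
qed

end

section \<open>Independent sets of paths and cycles\<close>

text \<open>
  On an interval these are the independent sets of a path.
\<close>

definition sparse_sets :: "nat set \<Rightarrow> nat set set" where
  "sparse_sets A = {S. S \<subseteq> A \<and> (\<forall>i\<in>S. Suc i \<notin> S)}"

lemma finite_sparse_sets: "finite A \<Longrightarrow> finite (sparse_sets A)"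
  by (auto simp: sparse_sets_def)

lemma card_split_element:
  assumes "finite C"
  shows "card C = card {S\<in>C. a \<notin> S} + card {S\<in>C. a \<in> S}"
proof -
  have "C = {S\<in>C. a \<notin> S} \<union> {S\<in>C. a \<in> S}" by auto
  then have "card C = card ({S\<in>C. a \<notin> S} \<union> {S\<in>C. a \<in> S})" by simp
  also have "\<dots> = card {S\<in>C. a \<notin> S} + card {S\<in>C. a \<in> S}"
    using assms by (intro card_Un_disjoint) auto
  finally show ?thesis .
qed

text \<open>
  Fibonacci recurrence: a sparse set avoids the last point, or contains it and then avoids the
  one before it.
\<close>

lemma card_sparse_sets_Suc_Suc:
  "card (sparse_sets {a..<a + Suc (Suc k)}) =
   card (sparse_sets {a..<a + Suc k}) + card (sparse_sets {a..<a + k})"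
proof -
  let ?C = "sparse_sets {a..<a + Suc (Suc k)}"
  let ?b = "a + Suc k"
  have "{S\<in>?C. ?b \<notin> S} = sparse_sets {a..<a + Suc k}"
    by (fastforce simp: sparse_sets_def less_Suc_eq)
  moreover have "{S\<in>?C. ?b \<in> S} = insert ?b ` sparse_sets {a..<a + k}"
  proof (intro equalityI subsetI)
    fix S assume S: "S \<in> {S\<in>?C. ?b \<in> S}"
    have "S - {?b} \<subseteq> {a..<a + k}"
    proof
      fix i assume i: "i \<in> S - {?b}"
      then have "i \<noteq> a + k" using S by (auto simp: sparse_sets_def)
      then show "i \<in> {a..<a + k}" using S i by (auto simp: sparse_sets_def)
    qed
    then have "S - {?b} \<in> sparse_sets {a..<a + k}"
      using S by (auto simp: sparse_sets_def)
    moreover have "S = insert ?b (S - {?b})" using S by auto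
    ultimately show "S \<in> insert ?b ` sparse_sets {a..<a + k}" by blast
  qed (fastforce simp: sparse_sets_def)
  moreover have "card (insert ?b ` sparse_sets {a..<a + k}) = card (sparse_sets {a..<a + k})"
  proof (rule card_image, rule inj_onI)
    fix S T assume *: "S \<in> sparse_sets {a..<a + k}" "T \<in> sparse_sets {a..<a + k}"
      "insert ?b S = insert ?b T"
    then have "?b \<notin> S" "?b \<notin> T" by (auto simp: sparse_sets_def)
    with *(3) show "S = T" by (simp add: insert_ident)
  qed
  ultimately show ?thesis
    using card_split_element[of ?C ?b] finite_sparse_sets by simp
qed

lemma card_sparse_sets_0: "card (sparse_sets {a..<a + 0}) = 1"
proof -
  have "sparse_sets {a..<a + 0} = {{}}" by (auto simp: sparse_sets_def)
  then show ?thesis by simp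
qed

lemma card_sparse_sets_1: "card (sparse_sets {a..<a + Suc 0}) = 2"
proof -
  have "sparse_sets {a..<a + Suc 0} = {{}, {a}}" by (auto simp: sparse_sets_def)
  then show ?thesis by simp
qed

text \<open>
  Both sides satisfy the same second-order recurrence in \<open>k\<close>. The starting points \<open>a\<close> and
  \<open>b\<close> differ because the two paths cut out of the cycle do not start at the same vertex.
\<close>

lemma card_sparse_sets_lucas:
  "card (sparse_sets {a..<a + Suc (Suc k)}) + card (sparse_sets {b..<b + k}) = lucas (k + 3)"
proof (induction k rule: lucas.induct)
  case 1
  show ?case
    using card_sparse_sets_Suc_Suc[of a 0]
    by (simp only: card_sparse_sets_0 card_sparse_sets_1) (simp add: numeral_eq_Suc)
next
  case 2
  show ?case
    using card_sparse_sets_Suc_Suc[of a 0] card_sparse_sets_Suc_Suc[of a "Suc 0"]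
    by (simp only: card_sparse_sets_0 card_sparse_sets_1) (simp add: numeral_eq_Suc)
next
  case (3 k)
  then show ?case
    using card_sparse_sets_Suc_Suc[of a "Suc (Suc k)"] card_sparse_sets_Suc_Suc[of b k]
    by (simp add: numeral_eq_Suc)
qed

definition cyclic_sparse_sets :: "nat \<Rightarrow> nat set set" where
  "cyclic_sparse_sets n = {S \<in> sparse_sets {1..n}. \<not> (1 \<in> S \<and> n \<in> S)}"

text \<open>
  Removing the point \<open>n\<close> from the cycle leaves the path \<open>1, ..., n - 1\<close>; removing its two
  neighbours as well leaves the path \<open>2, ..., n - 2\<close>.
\<close>

lemma card_cyclic_sparse_sets:
  assumes "n > 3"
  shows "card (cyclic_sparse_sets n) = lucas n"
proof -
  define k where "k = n - 3"
  have n: "n = k + 3" "k \<ge> 1" using assms by (auto simp: k_def)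
  let ?C = "cyclic_sparse_sets n"
  have "{S\<in>?C. n \<notin> S} = sparse_sets {1..<1 + Suc (Suc k)}"
    by (fastforce simp: cyclic_sparse_sets_def sparse_sets_def n le_Suc_eq numeral_eq_Suc)
  moreover have "{S\<in>?C. n \<in> S} = insert n ` sparse_sets {2..<2 + k}"
  proof (intro equalityI subsetI)
    fix S assume S: "S \<in> {S\<in>?C. n \<in> S}"
    have "S - {n} \<subseteq> {2..<2 + k}"
    proof
      fix i assume i: "i \<in> S - {n}"
      have "Suc i \<noteq> n" using S i by (auto simp: cyclic_sparse_sets_def sparse_sets_def)
      moreover have "i \<noteq> 1" using S i by (auto simp: cyclic_sparse_sets_def)
      moreover have "1 \<le> i" "i \<le> n"
        using S i by (auto simp: cyclic_sparse_sets_def sparse_sets_def)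
      ultimately show "i \<in> {2..<2 + k}" using i by (auto simp: n)
    qed
    then have "S - {n} \<in> sparse_sets {2..<2 + k}"
      using S by (auto simp: cyclic_sparse_sets_def sparse_sets_def)
    moreover have "S = insert n (S - {n})" using S by auto
    ultimately show "S \<in> insert n ` sparse_sets {2..<2 + k}" by blast
  next
    fix S assume "S \<in> insert n ` sparse_sets {2..<2 + k}"
    then show "S \<in> {S\<in>?C. n \<in> S}"
      by (fastforce simp: cyclic_sparse_sets_def sparse_sets_def n)
  qed
  moreover have "card (insert n ` sparse_sets {2..<2 + k}) = card (sparse_sets {2..<2 + k})"
  proof (rule card_image, rule inj_onI)
    fix S T assume *: "S \<in> sparse_sets {2..<2 + k}" "T \<in> sparse_sets {2..<2 + k}"
      "insert n S = insert n T"
    then have "n \<notin> S" "n \<notin> T" by (auto simp: sparse_sets_def n)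
    with *(3) show "S = T" by (simp add: insert_ident)
  qed
  moreover have "finite ?C"
    by (simp add: cyclic_sparse_sets_def finite_sparse_sets)
  ultimately show ?thesis
    using card_split_element[of ?C n] card_sparse_sets_lucas[of 1 k 2] n(1) by simp
qed

section \<open>Matchings of the cycle\<close>

definition share_vertex :: "edge \<Rightarrow> edge \<Rightarrow> bool" where
  "share_vertex d e \<longleftrightarrow> {fst d, snd d} \<inter> {fst e, snd e} \<noteq> {}"

definition nth_edge :: "nat \<Rightarrow> nat \<Rightarrow> edge" where
  "nth_edge n i = (if i = n then (1, n) else (i, i + 1))"

lemma cycle_edges_eq: "n > 3 \<Longrightarrow> cycle_edges n = nth_edge n ` {1..n}"
  by (auto simp: cycle_edges_def nth_edge_def image_iff)

lemma inj_nth_edge: "n > 3 \<Longrightarrow> inj_on (nth_edge n) {1..n}"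
  by (auto simp: inj_on_def nth_edge_def split: if_splits)

lemma share_vertex_nth_edge:
  assumes "n > 3" "i \<in> {1..n}" "j \<in> {1..n}" "i < j"
  shows "share_vertex (nth_edge n i) (nth_edge n j) \<longleftrightarrow> j = Suc i \<or> i = 1 \<and> j = n"
  using assms by (auto simp: share_vertex_def nth_edge_def)

text \<open>
  Under the numbering of the edges, consecutive numbers, and the pair \<open>1\<close>, \<open>n\<close>, are exactly the pairs
  of edges with a common vertex.
\<close>

lemma card_matchings:
  assumes "n > 3"
  shows "card (indep_sets (cycle_edges n) share_vertex) = lucas n"
proof -
  have sym: "share_vertex d e \<longleftrightarrow> share_vertex e d" for d e
    by (auto simp: share_vertex_def)
  have iff: "pairwise (\<lambda>d e. \<not> share_vertex d e) (nth_edge n ` S) \<longleftrightarrow> S \<in> cyclic_sparse_sets n"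
    if S: "S \<subseteq> {1..n}" for S
  proof -
    have inj: "inj_on (nth_edge n) S"
      using inj_nth_edge[OF assms] S by (rule inj_on_subset)
    have "pairwise (\<lambda>d e. \<not> share_vertex d e) (nth_edge n ` S) \<longleftrightarrow>
          (\<forall>i\<in>S. \<forall>j\<in>S. i \<noteq> j \<longrightarrow> \<not> share_vertex (nth_edge n i) (nth_edge n j))"
      using inj by (auto simp: pairwise_def inj_on_def)
    also have "\<dots> \<longleftrightarrow> (\<forall>i\<in>S. \<forall>j\<in>S. i < j \<longrightarrow> \<not> share_vertex (nth_edge n i) (nth_edge n j))"
      using sym by (metis nat_neq_iff)
    also have "\<dots> \<longleftrightarrow> (\<forall>i\<in>S. \<forall>j\<in>S. i < j \<longrightarrow> \<not> (j = Suc i \<or> i = 1 \<and> j = n))"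
      using share_vertex_nth_edge[OF assms] S by blast
    also have "\<dots> \<longleftrightarrow> S \<in> cyclic_sparse_sets n"
    proof
      assume *: "\<forall>i\<in>S. \<forall>j\<in>S. i < j \<longrightarrow> \<not> (j = Suc i \<or> i = 1 \<and> j = n)"
      have "\<not> (1 \<in> S \<and> n \<in> S)"
        using *[rule_format, of 1 n] assms by auto
      then show "S \<in> cyclic_sparse_sets n"
        using * S by (auto simp: cyclic_sparse_sets_def sparse_sets_def)
    qed (auto simp: cyclic_sparse_sets_def sparse_sets_def)
    finally show ?thesis .
  qed
  have "indep_sets (cycle_edges n) share_vertex = image (nth_edge n) ` cyclic_sparse_sets n"
  proof (intro equalityI subsetI)
    fix M assume "M \<in> indep_sets (cycle_edges n) share_vertex"
    then obtain S where "S \<subseteq> {1..n}" "M = nth_edge n ` S" "M \<in> indep_sets (cycle_edges n) share_vertex"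
      by (auto simp: indep_sets_def cycle_edges_eq[OF assms] subset_image_iff)
    then show "M \<in> image (nth_edge n) ` cyclic_sparse_sets n"
      using iff by (auto simp: indep_sets_def)
  next
    fix M assume "M \<in> image (nth_edge n) ` cyclic_sparse_sets n"
    then obtain S where S: "S \<in> cyclic_sparse_sets n" "M = nth_edge n ` S" by blast
    then have "S \<subseteq> {1..n}" by (simp add: cyclic_sparse_sets_def sparse_sets_def)
    then show "M \<in> indep_sets (cycle_edges n) share_vertex"
      using S iff by (auto simp: indep_sets_def cycle_edges_eq[OF assms])
  qed
  moreover have "inj_on (image (nth_edge n)) (cyclic_sparse_sets n)"
    using inj_on_image_Pow[OF inj_nth_edge[OF assms]]
    by (rule inj_on_subset) (auto simp: cyclic_sparse_sets_def sparse_sets_def)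
  ultimately show ?thesis
    using card_cyclic_sparse_sets[OF assms] by (simp add: card_image)
qed

text \<open>
  The commutation relations list each pair of edges once, in an order that depends on their
  position on the cycle; numbering the edges reduces the symmetric form required by the locale
  to the case of increasing numbers. Conversely, arrangement sums at matchings vanish on the relations: a product
  of clashing edges is not an arrangement of any matching, and both orders of a product are
  arrangements of the same set.
\<close>

lemma clash_ideal_FK_cycle:
  assumes n: "n > 3"
  shows "clash_ideal (cycle_edges n) share_vertex (FK_cycle_ideal n :: (edge, 'f::field) nc_poly set)"
proof -
  let ?E = "cycle_edges n"
  let ?R = "FK_cycle_relations n :: (edge, 'f) nc_poly set"
  let ?I = "FK_cycle_ideal n :: (edge, 'f) nc_poly set"
  interpret A: ring "free_algebra ?E :: (edge, 'f) nc_poly ring"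
    by (rule ring_free_algebra)
  have fin: "finite ?E"
    by (simp add: cycle_edges_eq[OF n])
  have rel: "p \<in> ?I" if "p \<in> ?R" for p
    using A.genideal_self[OF FK_cycle_relations_subset[OF n]] that
    by (auto simp: FK_cycle_ideal_def)
  let ?x = "\<lambda>i. nc_var (nth_edge n i) :: (edge, 'f) nc_poly"
  have square: "?x i * ?x i \<in> ?R" if "i \<in> {1..n}" for i
    using that by (auto simp: FK_cycle_relations_def nth_edge_def)
  have adjacent: "?x i * ?x j \<in> ?R \<and> ?x j * ?x i \<in> ?R"
    if "i \<in> {1..n}" "j \<in> {1..n}" "i < j" "j = Suc i \<or> i = 1 \<and> j = n" for i j
  proof (cases "j = n")
    case True
    then show ?thesis
      using that n by (auto simp: FK_cycle_relations_def nth_edge_def numeral_eq_Suc)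
  next
    case False
    then show ?thesis
      using that n by (auto simp: FK_cycle_relations_def nth_edge_def)
  qed
  have distant: "?x i * ?x j - ?x j * ?x i \<in> ?R"
    if "i \<in> {1..n}" "j \<in> {1..n}" "i < j" "\<not> (j = Suc i \<or> i = 1 \<and> j = n)" for i j
  proof (cases "j = n")
    case True
    then have "2 \<le> i" "i \<le> n - 2" "i \<noteq> n" using that by auto
    then show ?thesis
      using True by (auto simp: FK_cycle_relations_def nth_edge_def)
  next
    case False
    then have "1 \<le> i" "i \<le> j - 2" "3 \<le> j" "j \<le> n - 1" "i \<noteq> n" using that by auto
    then show ?thesis
      using False by (auto simp: FK_cycle_relations_def nth_edge_def)
  qed
  have ideal: "ideal ?I (free_algebra ?E)"
    using n by (rule ideal_FK_cycle_ideal)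
  have minus_closed: "- p \<in> ?I" if "p \<in> ?I" for p
    using ideal.I_l_closed[OF ideal that free_algebra_closed(1)[OF free_algebra_0_1_closed(2)]]
    by (simp add: free_algebra_simps)
  have sym: "share_vertex d e \<longleftrightarrow> share_vertex e d" for d e
    by (auto simp: share_vertex_def)
  show ?thesis
  proof (rule clash_ideal.intro)
    fix d e assume "d \<in> ?E" "e \<in> ?E"
    then obtain i j where ij: "i \<in> {1..n}" "d = nth_edge n i" "j \<in> {1..n}" "e = nth_edge n j"
      by (auto simp: cycle_edges_eq[OF n])
    show "nc_var d * nc_var e \<in> ?I" if "share_vertex d e"
      using that square[of i] adjacent[of i j] adjacent[of j i] sym
        share_vertex_nth_edge[OF n, of i j] share_vertex_nth_edge[OF n, of j i] ij
      by (cases i j rule: linorder_cases) (auto intro!: rel)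
    show "nc_var d * nc_var e - nc_var e * nc_var d \<in> ?I" if "\<not> share_vertex d e"
    proof (cases i j rule: linorder_cases)
      case less
      then show ?thesis
        using that distant[of i j] share_vertex_nth_edge[OF n, of i j] ij by (auto intro!: rel)
    next
      case equal
      then show ?thesis
        using that ij by (simp add: share_vertex_def)
    next
      case greater
      then have "nc_var e * nc_var d - nc_var d * nc_var e \<in> ?I"
        using that distant[of j i] share_vertex_nth_edge[OF n, of j i] ij sym by (auto intro!: rel)
      then show ?thesis
        using minus_closed by fastforce
    qed
  next
    have "?R \<subseteq> arrangement_kernel ?E share_vertex"
    proof
      fix p assume p: "p \<in> ?R"
      show "p \<in> arrangement_kernel ?E share_vertex"
        unfolding arrangement_kernel_def
      proof (intro CollectI conjI ballI)
        show "p \<in> carrier (free_algebra ?E)"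
          using p FK_cycle_relations_subset[OF n] by blast
        fix M assume M: "M \<in> indep_sets ?E share_vertex"
        have var_mult: "nc_var d * nc_var e = (nc_mono [d, e] 1 :: (edge, 'f) nc_poly)" for d e :: edge
          by (simp add: nc_var_def mult_single plus_free_word_def)
        have clash: "arrangement_sum M (nc_var d * nc_var e :: (edge, 'f) nc_poly) = 0"
          if "share_vertex d e" for d e
          using M that
          by (auto simp: var_mult arrangement_sum_single indep_sets_def pairwise_def)
        have comm:
          "arrangement_sum M (nc_var d * nc_var e - nc_var e * nc_var d :: (edge, 'f) nc_poly) = 0"
          for d e
          by (auto simp: var_mult arrangement_sum_diff arrangement_sum_single)
        show "arrangement_sum M p = 0"
          using p n unfolding FK_cycle_relations_def
          by (auto simp: comm intro!: clash) (auto simp: share_vertex_def)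
      qed
    qed
    then show "?I \<subseteq> arrangement_kernel ?E share_vertex"
      unfolding FK_cycle_ideal_def by (rule A.genideal_minimal[OF ideal_arrangement_kernel[OF fin]])
  qed (use fin ideal sym in \<open>auto simp: share_vertex_def\<close>)
qed

theorem corollary2p11:
  fixes n :: nat
  assumes "n > 3"
  shows "ring.dimension (FK_cycle n :: (edge, 'f::field) nc_poly set ring) (lucas n)
           (FK_cycle_scalars n) (carrier (FK_cycle n))"
proof -
  interpret clash_ideal "cycle_edges n" share_vertex "FK_cycle_ideal n :: (edge, 'f) nc_poly set"
    using assms by (rule clash_ideal_FK_cycle)
  show ?thesis
    using dimension_quot
    by (simp add: card_matchings[OF assms] FK_cycle_def FK_cycle_scalars_def scalars_def)
qed

end
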